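(* Let $k\ge3$ and let $P\in\mathcal{P}_3(k)$ be a finite poset. Then $\mathrm{bp}(\mathcal{B}(P))=\gamma_{\mathrm{os}}(P)$.
   Context: For a poset $P=(X,\le)$, $\mathrm{Max}(P)$ and $\mathrm{Min}(P)$ are the sets of maximal and minimal elements, and $\mathrm{Mid}(P)=X\setminus(\mathrm{Max}(P)\cup\mathrm{Min}(P))$. The height of $P$ is the maximum size (number of elements) of a chain. $\mathcal{P}_3(k)$ denotes the family of posets of height $k$ in which every element is contained in a chain of size at least $3$. The comparability graph $\mathrm{Comp}(P)$ has vertex set $X$, with $x\neq y$ adjacent iff $x<y$ or $y<x$. A dominating set of a graph is a set $S$ of vertices such that every vertex not in $S$ has a neighbor in $S$. An order-sensitive dominating set of $P$ is a dominating set $D$ of $\mathrm{Comp}(P)$ such that for every $x\in\mathrm{Mid}(P)$, either $x\in D$ or there are $a,b\in D$ with $a<x<b$. $\gamma_{\mathrm{os}}(P)$ is the minimum size of an order-sensitive dominating set of $P$. The bipartite transformation $\mathcal{B}(P)$ is the bipartite graph with vertex set $V_1\cup V_2$ (disjoint), where $V_1=\{x' : x\in\mathrm{Min}(P)\cup\mathrm{Mid}(P)\}$ and $V_2=\{x'' : x\in\mathrm{Max}(P)\cup\mathrm{Mid}(P)\}$, and $x'y''$ is an edge iff either $x<y$ in $P$ or $x=y\in\mathrm{Mid}(P)$. A biclique in a graph $G$ is a (not necessarily induced) subgraph of $G$ isomorphic to a complete bipartite graph $K_{p,q}$ with $p,q\ge1$. A biclique vertex-partition of $G$ is a set of pairwise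 vertex-disjoint bicliques such that each vertex of $G$ belongs to exactly one of them; $\mathrm{bp}(G)$ is the least size of a biclique vertex-partition of $G$. (Following the literature, the paper does not distinguish this from the least size of a biclique vertex-cover, i.e. a set of bicliques such that each vertex belongs to at least one of them.) *)

theory Defs
  imports "HOL-Library.Disjoint_Sets" "Graph_Theory.Graph_Theory"
begin

text \<open>
  A poset is a carrier \<open>X\<close> with a reflexive order \<open>r\<close> such that \<^term>\<open>partial_order_on X r\<close>;
  this includes \<open>r \<subseteq> X \<times> X\<close>, so every member of \<^term>\<open>Chains r\<close> is a subset of \<open>X\<close>.
\<close>

definition strictly_below :: "'a rel \<Rightarrow> 'a \<Rightarrow> 'a \<Rightarrow> bool" where
  "strictly_below r x y \<longleftrightarrow> (x, y) \<in> r \<and> x \<noteq> y"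

definition max_elems :: "'a set \<Rightarrow> 'a rel \<Rightarrow> 'a set" where
  "max_elems X r = {x \<in> X. \<not> (\<exists>y\<in>X. strictly_below r x y)}"

definition min_elems :: "'a set \<Rightarrow> 'a rel \<Rightarrow> 'a set" where
  "min_elems X r = {x \<in> X. \<not> (\<exists>y\<in>X. strictly_below r y x)}"

definition mid_elems :: "'a set \<Rightarrow> 'a rel \<Rightarrow> 'a set" where
  "mid_elems X r = X - (max_elems X r \<union> min_elems X r)"

text \<open>Meaningful for finite posets only, since it relies on \<^const>\<open>Max\<close> and \<^const>\<open>card\<close>.\<close>

definition height :: "'a rel \<Rightarrow> nat" where
  "height r = Max (card ` Chains r)"

definition posets3 :: "nat \<Rightarrow> ('a set \<times> 'a rel) set" where
  "posets3 k = {(X, r). partial_order_on X r \<and> height r = k \<and>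
     (\<forall>x\<in>X. \<exists>C\<in>Chains r. x \<in> C \<and> 3 \<le> card C)}"

text \<open>
  Undirected simple graphs are represented as loop-free symmetric digraphs (\<^locale>\<open>pair_graph\<close>):
  an edge consists of two opposite arcs.
\<close>

definition comparability_graph :: "'a set \<Rightarrow> 'a rel \<Rightarrow> 'a pair_pre_digraph" where
  "comparability_graph X r =
     \<lparr> pverts = X,
       parcs = {(x, y) \<in> X \<times> X. strictly_below r x y \<or> strictly_below r y x} \<rparr>"

definition dominating_set :: "'a pair_pre_digraph \<Rightarrow> 'a set \<Rightarrow> bool" where
  "dominating_set G S \<longleftrightarrow>
     S \<subseteq> pverts G \<and> (\<forall>v \<in> pverts G - S. \<exists>u\<in>S. (v, u) \<in> parcs G)"

definition order_sensitive_dominating_set :: "'a set \<Rightarrow> 'a rel \<Rightarrow> 'a set \<Rightarrow> bool" where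
  "order_sensitive_dominating_set X r D \<longleftrightarrow>
     dominating_set (comparability_graph X r) D \<and>
     (\<forall>x \<in> mid_elems X r. x \<in> D \<or>
        (\<exists>a\<in>D. \<exists>b\<in>D. strictly_below r a x \<and> strictly_below r x b))"

definition gamma_os :: "'a set \<Rightarrow> 'a rel \<Rightarrow> nat" where
  "gamma_os X r =
     (LEAST n. \<exists>D. order_sensitive_dominating_set X r D \<and> finite D \<and> card D = n)"

text \<open>The copies \<open>x'\<close> and \<open>x''\<close> of an element \<open>x\<close> are \<^term>\<open>Inl x\<close> and \<^term>\<open>Inr x\<close>.\<close>

definition bip_edges :: "'a set \<Rightarrow> 'a rel \<Rightarrow> ('a + 'a) rel" where
  "bip_edges X r =
     {(Inl x, Inr y) | x y.
        x \<in> min_elems X r \<union> mid_elems X r \<and> y \<in> max_elems X r \<union> mid_elems X r \<and>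
        (strictly_below r x y \<or> x = y \<and> x \<in> mid_elems X r)}"

definition bipartite_transformation :: "'a set \<Rightarrow> 'a rel \<Rightarrow> ('a + 'a) pair_pre_digraph" where
  "bipartite_transformation X r =
     \<lparr> pverts = Inl ` (min_elems X r \<union> mid_elems X r) \<union> Inr ` (max_elems X r \<union> mid_elems X r),
       parcs = bip_edges X r \<union> (bip_edges X r)\<inverse> \<rparr>"

definition biclique :: "'v pair_pre_digraph \<Rightarrow> 'v pair_pre_digraph \<Rightarrow> bool" where
  "biclique H G \<longleftrightarrow> subgraph (with_proj H) (with_proj G) \<and>
     (\<exists>p q. 1 \<le> p \<and> 1 \<le> q \<and> complete_bipartite_digraph p q (with_proj H))"

definition biclique_vertex_partition ::
    "'v pair_pre_digraph set \<Rightarrow> 'v pair_pre_digraph \<Rightarrow> bool" where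
  "biclique_vertex_partition \<B> G \<longleftrightarrow>
     (\<forall>H\<in>\<B>. biclique H G) \<and> disjoint_family_on pverts \<B> \<and>
     (\<forall>v\<in>pverts G. \<exists>!H. H \<in> \<B> \<and> v \<in> pverts H)"

definition bp :: "'v pair_pre_digraph \<Rightarrow> nat" where
  "bp G = (LEAST n. \<exists>\<B>. biclique_vertex_partition \<B> G \<and> finite \<B> \<and> card \<B> = n)"

lemma pair_graph_comparability_graph:
  assumes "finite X"
  shows "pair_graph (comparability_graph X r)"
proof -
  have "finite (parcs (comparability_graph X r))"
    by (rule finite_subset[of _ "X \<times> X"]) (auto simp: comparability_graph_def assms)
  then show ?thesis
    using assms
    by unfold_locales
      (auto simp: comparability_graph_def strictly_below_def symmetric_def sym_def)
qed

lemma pair_graph_bipartite_transformation: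
  assumes "finite X"
  shows "pair_graph (bipartite_transformation X r)"
proof -
  have V: "finite (pverts (bipartite_transformation X r))"
    using assms
    by (simp add: bipartite_transformation_def min_elems_def max_elems_def mid_elems_def)
  have "parcs (bipartite_transformation X r) \<subseteq>
      pverts (bipartite_transformation X r) \<times> pverts (bipartite_transformation X r)"
    by (auto simp: bipartite_transformation_def bip_edges_def)
  then have "finite (parcs (bipartite_transformation X r))"
    using V finite_subset by blast
  with V show ?thesis
    by unfold_locales
      (auto simp: bipartite_transformation_def bip_edges_def symmetric_def sym_def)
qed

end

theory Submission
  imports Defs
begin

text \<open>
  Both parameters equal the least size of a set \<open>D\<close> such that every middle element \<open>x\<close> satisfies
  \<open>a \<le> x \<le> b\<close> for some \<open>a, b \<in> D\<close>; the extremal elements are then dominated automatically, because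
  each of them is comparable to a middle element.

  Given such a \<open>D\<close>, send each \<open>x'\<close> to an element of \<open>D\<close> above \<open>x\<close> and each \<open>x''\<close> to an element of
  \<open>D\<close> below \<open>x\<close>, and let the fibre over \<open>d\<close> be the biclique with centre \<open>d\<close>.  Only images
  of middle elements are used as centres, and an extremal element that is such an image is sent to
  itself: this makes both sides of every fibre nonempty.  Conversely, call
  a biclique centred if some \<open>d\<close> lies above every middle \<open>x\<close> with \<open>x'\<close> in it and below every middle
  \<open>x\<close> with \<open>x''\<close> in it.  The chosen centres bracket all middle elements: if \<open>x''\<close> lies in a biclique
  without a centre, then that biclique contains \<open>a'\<close> for a middle element \<open>a < x\<close>, and
  one descends to \<open>a\<close>.
\<close>

text \<open>Each construction below may return a smaller family than the one it starts from, so the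
  hypotheses allow \<open>m \<le> n\<close>. One satisfiable side suffices: \<open>PQ\<close>
  carries a witness over to the other, and both \<open>LEAST\<close> terms are then
  attained.\<close>

lemma Least_eq_Least:
  fixes P Q :: "nat \<Rightarrow> bool"
  assumes "\<exists>n. P n"
    and PQ: "\<And>n. P n \<Longrightarrow> \<exists>m\<le>n. Q m"
    and QP: "\<And>n. Q n \<Longrightarrow> \<exists>m\<le>n. P m"
  shows "(LEAST n. P n) = (LEAST n. Q n)"
proof (rule antisym)
  have "\<exists>n. Q n"
    using assms(1) PQ by blast
  then have "Q (LEAST n. Q n)"
    by (rule LeastI_ex)
  then show "(LEAST n. P n) \<le> (LEAST n. Q n)"
    using QP by (meson Least_le le_trans)
  have "P (LEAST n. P n)"
    using assms(1) by (rule LeastI_ex)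
  then show "(LEAST n. Q n) \<le> (LEAST n. P n)"
    using PQ by (meson Least_le le_trans)
qed

section \<open>Order reversal\<close>

lemma strictly_below_converse [simp]: "strictly_below (r\<inverse>) x y \<longleftrightarrow> strictly_below r y x"
  by (auto simp: strictly_below_def)

lemma max_elems_converse [simp]: "max_elems X (r\<inverse>) = min_elems X r"
  by (simp add: max_elems_def min_elems_def)

lemma min_elems_converse [simp]: "min_elems X (r\<inverse>) = max_elems X r"
  by (simp add: max_elems_def min_elems_def)

lemma mid_elems_converse [simp]: "mid_elems X (r\<inverse>) = mid_elems X r"
  by (simp add: mid_elems_def Un_commute)

lemma Chains_converse [simp]: "Chains (r\<inverse>) = Chains r"
  by (auto simp: Chains_def)

text \<open>Reflexivity of \<open>r\<close> absorbs the case \<open>x \<in> D\<close>: then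
  \<open>x\<close> serves as both \<open>a\<close> and \<open>b\<close>. In this form the notion is
  visibly self-dual.\<close>

definition bracketing :: "'a set \<Rightarrow> 'a rel \<Rightarrow> 'a set \<Rightarrow> bool" where
  "bracketing X r D \<longleftrightarrow>
     D \<subseteq> X \<and> (\<forall>x\<in>mid_elems X r. (\<exists>a\<in>D. (a, x) \<in> r) \<and> (\<exists>b\<in>D. (x, b) \<in> r))"

lemma bracketing_converse [simp]: "bracketing X (r\<inverse>) D \<longleftrightarrow> bracketing X r D"
  by (auto simp: bracketing_def)

definition biclique_on :: "'a set \<Rightarrow> 'a set \<Rightarrow> ('a + 'a) pair_pre_digraph" where
  "biclique_on A C = \<lparr> pverts = Inl ` A \<union> Inr ` C,
     parcs = Inl ` A \<times> Inr ` C \<union> Inr ` C \<times> Inl ` A \<rparr>"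

section \<open>Finite posets covered by chains of size at least three\<close>

locale finite_poset3 =
  fixes X :: "'a set" and r :: "'a rel"
  assumes finite: "finite X"
    and order: "partial_order_on X r"
    and chains: "\<And>x. x \<in> X \<Longrightarrow> \<exists>C\<in>Chains r. x \<in> C \<and> 3 \<le> card C"
begin

text \<open>Each fact of the locale thereby has a mirror image, obtained at
  \<open>r\<inverse>\<close>, with minimal and maximal elements exchanged.\<close>

lemma dual: "finite_poset3 X (r\<inverse>)"
  using finite order chains by unfold_locales auto

lemma refl: "x \<in> X \<Longrightarrow> (x, x) \<in> r"
  and trans: "(x, y) \<in> r \<Longrightarrow> (y, z) \<in> r \<Longrightarrow> (x, z) \<in> r"
  and antisym: "(x, y) \<in> r \<Longrightarrow> (y, x) \<in> r \<Longrightarrow> x = y"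
  and carrier: "(x, y) \<in> r \<Longrightarrow> x \<in> X \<and> y \<in> X"
  using order unfolding partial_order_on_def preorder_on_def refl_on_def
  by (blast dest: transD antisymD)+

lemma elems_subset: "min_elems X r \<subseteq> X" "max_elems X r \<subseteq> X" "mid_elems X r \<subseteq> X"
  by (auto simp: min_elems_def max_elems_def mid_elems_def)

text \<open>A chain of size at least 3 through \<open>x\<close> contains two further elements, both
  above the minimal \<open>x\<close> and comparable to each other. The lower of the two lies
  strictly between \<open>x\<close> and the other, so it is neither minimal nor maximal.\<close>

lemma mid_above_min:
  assumes "x \<in> min_elems X r"
  obtains m where "m \<in> mid_elems X r" "strictly_below r x m"
proof -
  have x: "x \<in> X" "\<And>y. (y, x) \<in> r \<Longrightarrow> y = x"
    using assms carrier by (auto simp: min_elems_def strictly_below_def)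
  obtain C where C: "C \<in> Chains r" "x \<in> C" "3 \<le> card C"
    using chains x(1) by blast
  have "2 \<le> card (C - {x})"
    using C by (simp add: card_Diff_singleton)
  then obtain y z where yz: "y \<in> C" "z \<in> C" "y \<noteq> x" "z \<noteq> x" "y \<noteq> z"
    by (auto simp: card_le_Suc_iff numeral_2_eq_2)
  have below: "(x, y) \<in> r" "(x, z) \<in> r"
    using C yz x(2) unfolding Chains_def by blast+
  have "(y, z) \<in> r \<or> (z, y) \<in> r"
    using C yz unfolding Chains_def by blast
  moreover have "u \<in> mid_elems X r \<and> strictly_below r x u"
    if "(x, u) \<in> r" "(u, v) \<in> r" "u \<noteq> x" "u \<noteq> v" for u v
    using that carrier[of x u] carrier[of u v]
    by (auto simp: mid_elems_def min_elems_def max_elems_def strictly_below_def)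
  ultimately show thesis
    using that below yz by blast
qed

lemma mid_below_max:
  assumes "x \<in> max_elems X r"
  obtains m where "m \<in> mid_elems X r" "strictly_below r m x"
  using finite_poset3.mid_above_min[OF dual, of x] assms by auto

lemma min_max_disjoint: "min_elems X r \<inter> max_elems X r = {}"
proof -
  have "x \<notin> max_elems X r" if "x \<in> min_elems X r" for x
    using that by (rule mid_above_min) (use elems_subset in \<open>auto simp: max_elems_def\<close>)
  then show ?thesis by blast
qed

section \<open>Order-sensitive domination as bracketing\<close>

lemma order_sensitive_dominating_set_iff_bracketing:
  "order_sensitive_dominating_set X r D \<longleftrightarrow> bracketing X r D"
proof
  assume D: "order_sensitive_dominating_set X r D"
  then have "D \<subseteq> X"
    by (simp add: order_sensitive_dominating_set_def dominating_set_def comparability_graph_def)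
  moreover have "(\<exists>a\<in>D. (a, x) \<in> r) \<and> (\<exists>b\<in>D. (x, b) \<in> r)" if "x \<in> mid_elems X r" for x
    using D that refl[of x] elems_subset(3)
    unfolding order_sensitive_dominating_set_def strictly_below_def by blast
  ultimately show "bracketing X r D"
    by (simp add: bracketing_def)
next
  assume D: "bracketing X r D"
  have mid: "x \<in> D \<or> (\<exists>a\<in>D. \<exists>b\<in>D. strictly_below r a x \<and> strictly_below r x b)"
    if "x \<in> mid_elems X r" for x
    using D that unfolding bracketing_def strictly_below_def by blast
  have "\<exists>u\<in>D. strictly_below r x u \<or> strictly_below r u x" if "x \<in> X - D" for x
  proof -
    consider "x \<in> mid_elems X r" | "x \<in> min_elems X r" | "x \<in> max_elems X r"
      using \<open>x \<in> X - D\<close> by (auto simp: mid_elems_def)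
    then show ?thesis
    proof cases
      case 1
      then show ?thesis using mid that by blast
    next
      case 2
      then obtain m where m: "m \<in> mid_elems X r" "strictly_below r x m"
        by (rule mid_above_min)
      \<comment> \<open>The element \<open>b\<close> above \<open>m\<close> is also above
        \<open>x\<close>, and it differs from \<open>x\<close> because \<open>x\<close> lies outside
        \<open>D\<close>.\<close>
      then obtain b where "b \<in> D" "(m, b) \<in> r"
        using D by (auto simp: bracketing_def)
      then show ?thesis
        using m that trans unfolding strictly_below_def by blast
    next
      case 3
      then obtain m where m: "m \<in> mid_elems X r" "strictly_below r m x"
        by (rule mid_below_max)
      then obtain a where "a \<in> D" "(a, m) \<in> r"
        using D by (auto simp: bracketing_def)
      then show ?thesis
        using m that trans unfolding strictly_below_def by blast
    qed
  qed
  moreover have "D \<subseteq> X"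
    using D by (simp add: bracketing_def)
  ultimately show "order_sensitive_dominating_set X r D"
    using mid unfolding order_sensitive_dominating_set_def dominating_set_def
    by (simp add: comparability_graph_def) blast
qed

section \<open>Bicliques of the bipartite transformation\<close>

lemma bip_edges_iff:
  "(Inl x, Inr y) \<in> bip_edges X r \<longleftrightarrow>
     x \<in> min_elems X r \<union> mid_elems X r \<and> y \<in> max_elems X r \<union> mid_elems X r \<and> (x, y) \<in> r"
  \<comment> \<open>A pair with \<open>x = y\<close> outside the middle would be both minimal and
    maximal, so the two alternatives of the definition together amount to
    \<open>(x, y) \<in> r\<close>.\<close>
  using min_max_disjoint refl elems_subset
  by (auto simp: bip_edges_def strictly_below_def)

lemma biclique_on_biclique:
  assumes "A \<noteq> {}" "C \<noteq> {}" "Inl ` A \<times> Inr ` C \<subseteq> bip_edges X r"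
  shows "biclique (biclique_on A C) (bipartite_transformation X r)"
proof -
  have sub: "A \<subseteq> min_elems X r \<union> mid_elems X r" "C \<subseteq> max_elems X r \<union> mid_elems X r"
    using assms by (auto simp: bip_edges_def)
  then have fin: "finite A" "finite C"
    using finite elems_subset by (meson finite_subset le_sup_iff order_trans)+
  interpret B: pair_graph "bipartite_transformation X r"
    using finite by (rule pair_graph_bipartite_transformation)
  have "complete_bipartite_digraph (card A) (card C) (with_proj (biclique_on A C))"
    unfolding complete_bipartite_digraph_pair_def biclique_on_def
    using fin
    by (intro conjI exI[of _ "Inl ` A"] exI[of _ "Inr ` C"]) (auto simp: card_image)
  moreover have "1 \<le> card A" "1 \<le> card C"
    using assms fin by (simp_all add: Suc_le_eq card_gt_0_iff)
  moreover have "wf_digraph (with_proj (biclique_on A C))"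
    by unfold_locales (auto simp: biclique_on_def)
  moreover have "pverts (biclique_on A C) \<subseteq> pverts (bipartite_transformation X r)"
    using sub by (auto simp: biclique_on_def bipartite_transformation_def)
  moreover have "parcs (biclique_on A C) \<subseteq> parcs (bipartite_transformation X r)"
    using assms(3) by (auto simp: biclique_on_def bipartite_transformation_def)
  ultimately show ?thesis
    using B.wf_digraph unfolding biclique_def subgraph_def compatible_def by auto
qed

text \<open>The two parts \<open>U\<close>, \<open>V\<close> of the biclique come without any
  relation to the copies \<open>Inl\<close>, \<open>Inr\<close>. Since every vertex of
  \<open>U\<close> is joined to every vertex of \<open>V\<close> and edges only join different
  copies, one part consists of \<open>Inl\<close> vertices and the other of \<open>Inr\<close>
  vertices.\<close>

lemma bicliqueE:
  assumes "biclique H (bipartite_transformation X r)"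
  obtains a c where "Inl a \<in> pverts H" "Inr c \<in> pverts H"
    and "\<And>x y. Inl x \<in> pverts H \<Longrightarrow> Inr y \<in> pverts H \<Longrightarrow> (x, y) \<in> r"
proof -
  obtain U V where UV: "pverts H = U \<union> V" "parcs H = U \<times> V \<union> V \<times> U" "U \<noteq> {}" "V \<noteq> {}"
    using assms unfolding biclique_def complete_bipartite_digraph_pair_def
    by (metis card.empty not_one_le_zero)
  have "parcs H \<subseteq> bip_edges X r \<union> (bip_edges X r)\<inverse>"
    using assms by (auto simp: biclique_def subgraph_def bipartite_transformation_def)
  then have edge: "(u, v) \<in> bip_edges X r \<or> (v, u) \<in> bip_edges X r" if "u \<in> U" "v \<in> V" for u v
    using that UV by blast
  have opposite: "isl u \<longleftrightarrow> \<not> isl v" if "u \<in> U" "v \<in> V" for u v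
    using edge[OF that] by (auto simp: bip_edges_def)
  obtain u v where uv: "u \<in> U" "v \<in> V"
    using UV by blast
  have "\<exists>a c. Inl a \<in> pverts H \<and> Inr c \<in> pverts H"
    using edge[OF uv] uv UV by (auto simp: bip_edges_def)
  moreover have "(x, y) \<in> r" if "Inl x \<in> pverts H" "Inr y \<in> pverts H" for x y
  proof -
    have "Inl x \<in> U \<and> Inr y \<in> V \<or> Inr y \<in> U \<and> Inl x \<in> V"
      using that uv opposite UV(1) by (metis UnE isl_def sum.disc(2))
    then have "(Inl x, Inr y) \<in> bip_edges X r"
      using edge by (fastforce simp: bip_edges_def)
    then show ?thesis by (simp add: bip_edges_iff)
  qed
  ultimately show thesis using that by blast
qed

section \<open>From a bracketing set to a biclique partition\<close>

lemma upper_assignment_mid: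
  assumes "bracketing X r D"
  shows "\<exists>F. \<forall>x\<in>mid_elems X r. F x \<in> D \<and> (x, F x) \<in> r \<and> (x \<in> D \<longrightarrow> F x = x)"
proof (rule bchoice, rule ballI)
  fix x assume x: "x \<in> mid_elems X r"
  then show "\<exists>y. y \<in> D \<and> (x, y) \<in> r \<and> (x \<in> D \<longrightarrow> y = x)"
    using assms refl[of x] elems_subset by (cases "x \<in> D") (auto simp: bracketing_def)
qed

lemma upper_assignment_min:
  assumes "\<And>x. x \<in> mid_elems X r \<Longrightarrow> (x, F x) \<in> r"
  shows "\<exists>f. (\<forall>x\<in>mid_elems X r. f x = F x) \<and>
    (\<forall>x \<in> min_elems X r \<union> mid_elems X r. (x, f x) \<in> r \<and> f x \<in> F ` mid_elems X r \<union> S) \<and>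
    (\<forall>x \<in> min_elems X r \<inter> S. f x = x)"
proof -
  have "\<forall>x\<in>min_elems X r. \<exists>m. m \<in> mid_elems X r \<and> (x, m) \<in> r"
    by (meson mid_above_min strictly_below_def)
  from bchoice[OF this] obtain h
    where h: "\<And>x. x \<in> min_elems X r \<Longrightarrow> h x \<in> mid_elems X r \<and> (x, h x) \<in> r"
    by blast
  define f where "f x = (if x \<in> mid_elems X r then F x else if x \<in> S then x else F (h x))" for x
  have "(x, F (h x)) \<in> r" if "x \<in> min_elems X r" for x
    using h[OF that] assms trans by blast
  then have "(x, f x) \<in> r \<and> f x \<in> F ` mid_elems X r \<union> S"
    if "x \<in> min_elems X r \<union> mid_elems X r" for x
    using that assms h refl elems_subset by (auto simp: f_def)
  moreover have "f x = x" if "x \<in> min_elems X r \<inter> S" for x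
    using that by (auto simp: f_def mid_elems_def)
  ultimately show ?thesis
    by (intro exI[of _ f]) (auto simp: f_def)
qed

lemma below_mid_cases:
  assumes "(x, m) \<in> r" "m \<in> mid_elems X r"
  shows "x \<in> min_elems X r \<or> x \<in> mid_elems X r"
  using assms carrier[of x m]
  by (cases "x = m") (auto simp: mid_elems_def max_elems_def strictly_below_def)

text \<open>A value of \<open>F\<close> has a middle preimage. A value \<open>d\<close> of
  \<open>G\<close> lies below a middle element, hence is minimal or middle, and \<open>f\<close>
  fixes it: by the last clause on \<open>f\<close> if minimal, by the clause on \<open>F\<close> and
  \<open>d \<in> D\<close> if middle.\<close>

lemma fibre_nonempty:
  assumes F: "\<And>x. x \<in> mid_elems X r \<Longrightarrow> x \<in> D \<Longrightarrow> F x = x"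
    and f: "\<And>x. x \<in> mid_elems X r \<Longrightarrow> f x = F x"
      "\<And>x. x \<in> min_elems X r \<Longrightarrow> x \<in> G ` mid_elems X r \<Longrightarrow> f x = x"
    and G: "\<And>x. x \<in> mid_elems X r \<Longrightarrow> G x \<in> D \<and> (G x, x) \<in> r"
    and d: "d \<in> F ` mid_elems X r \<union> G ` mid_elems X r"
  shows "{x \<in> min_elems X r \<union> mid_elems X r. f x = d} \<noteq> {}"
  using d
proof
  assume "d \<in> F ` mid_elems X r"
  then show ?thesis using f(1) by auto
next
  assume dG: "d \<in> G ` mid_elems X r"
  then have "d \<in> D" "d \<in> min_elems X r \<or> d \<in> mid_elems X r"
    using G below_mid_cases by blast+
  then show ?thesis using F f dG by auto
qed

lemma partition_of_bracketing:
  assumes D: "bracketing X r D"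
  shows "\<exists>\<B>. biclique_vertex_partition \<B> (bipartite_transformation X r) \<and>
    finite \<B> \<and> card \<B> \<le> card D"
proof -
  interpret op: finite_poset3 X "r\<inverse>"
    by (rule dual)
  let ?M = "mid_elems X r"
  obtain F where F: "\<And>x. x \<in> ?M \<Longrightarrow> F x \<in> D \<and> (x, F x) \<in> r" "\<And>x. x \<in> ?M \<Longrightarrow> x \<in> D \<Longrightarrow> F x = x"
    using upper_assignment_mid[OF D] by metis
  obtain G where G: "\<And>x. x \<in> ?M \<Longrightarrow> G x \<in> D \<and> (G x, x) \<in> r" "\<And>x. x \<in> ?M \<Longrightarrow> x \<in> D \<Longrightarrow> G x = x"
    using op.upper_assignment_mid[of D] D by auto
  \<comment> \<open>Only values actually taken on middle elements become centres: over another
    element of \<open>D\<close> a fibre could be empty on one side and so give no biclique.\<close>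
  define E where "E = F ` ?M \<union> G ` ?M"
  have "finite D"
    using D finite finite_subset by (auto simp: bracketing_def)
  moreover have "E \<subseteq> D"
    using F G by (auto simp: E_def)
  ultimately have E: "finite E" "card E \<le> card D"
    by (auto intro: finite_subset card_mono)
  have "\<exists>f. (\<forall>x\<in>?M. f x = F x) \<and>
    (\<forall>x \<in> min_elems X r \<union> ?M. (x, f x) \<in> r \<and> f x \<in> F ` ?M \<union> G ` ?M) \<and>
    (\<forall>x \<in> min_elems X r \<inter> G ` ?M. f x = x)"
    by (rule upper_assignment_min) (simp add: F(1))
  then obtain f where "(\<forall>x\<in>?M. f x = F x) \<and>
    (\<forall>x \<in> min_elems X r \<union> ?M. (x, f x) \<in> r \<and> f x \<in> F ` ?M \<union> G ` ?M) \<and>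
    (\<forall>x \<in> min_elems X r \<inter> G ` ?M. f x = x)" ..
  then have f: "\<And>x. x \<in> ?M \<Longrightarrow> f x = F x"
    "\<And>x. x \<in> min_elems X r \<union> ?M \<Longrightarrow> (x, f x) \<in> r \<and> f x \<in> F ` ?M \<union> G ` ?M"
    "\<And>x. x \<in> min_elems X r \<Longrightarrow> x \<in> G ` ?M \<Longrightarrow> f x = x"
    by simp_all
  \<comment> \<open>The mirror image of the construction of \<open>f\<close>, with the image of
    \<open>F\<close> as the set of maximal elements to be fixed.\<close>
  have "\<exists>g. (\<forall>x\<in>?M. g x = G x) \<and>
    (\<forall>x \<in> max_elems X r \<union> ?M. (g x, x) \<in> r \<and> g x \<in> G ` ?M \<union> F ` ?M) \<and>
    (\<forall>x \<in> max_elems X r \<inter> F ` ?M. g x = x)"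
    using op.upper_assignment_min[of G "F ` ?M"] G by simp
  then obtain g where "(\<forall>x\<in>?M. g x = G x) \<and>
    (\<forall>x \<in> max_elems X r \<union> ?M. (g x, x) \<in> r \<and> g x \<in> G ` ?M \<union> F ` ?M) \<and>
    (\<forall>x \<in> max_elems X r \<inter> F ` ?M. g x = x)" ..
  then have g: "\<And>x. x \<in> ?M \<Longrightarrow> g x = G x"
    "\<And>x. x \<in> max_elems X r \<union> ?M \<Longrightarrow> (g x, x) \<in> r \<and> g x \<in> G ` ?M \<union> F ` ?M"
    "\<And>x. x \<in> max_elems X r \<Longrightarrow> x \<in> F ` ?M \<Longrightarrow> g x = x"
    by simp_all
  define A where "A d = {x \<in> min_elems X r \<union> ?M. f x = d}" for d
  define C where "C d = {x \<in> max_elems X r \<union> ?M. g x = d}" for d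
  have A: "A d \<noteq> {}" if "d \<in> E" for d
    unfolding A_def using F(2) f(1,3) G(1) that unfolding E_def by (rule fibre_nonempty)
  have C: "C d \<noteq> {}" if "d \<in> E" for d
    using op.fibre_nonempty[of D G g F d] G(2) g(1,3) F(1) that unfolding E_def C_def by auto
  have edges: "Inl ` A d \<times> Inr ` C d \<subseteq> bip_edges X r" for d
  proof -
    \<comment> \<open>The centre links the two sides: \<open>x\<close> is below
      \<open>f x = d\<close>, and \<open>d = g y\<close> is below \<open>y\<close>.\<close>
    have "(x, y) \<in> r" if "x \<in> A d" "y \<in> C d" for x y
      using f(2)[of x] g(2)[of y] that by (intro trans[of x d y]) (auto simp: A_def C_def)
    then show ?thesis
      by (auto simp: A_def C_def bip_edges_iff)
  qed
  define H where "H d = biclique_on (A d) (C d)" for d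
  have H: "biclique (H d) (bipartite_transformation X r)" if "d \<in> E" for d
    unfolding H_def using A[OF that] C[OF that] edges by (rule biclique_on_biclique)
  have unique: "d = e" if "v \<in> pverts (H d)" "v \<in> pverts (H e)" for v d e
    using that by (auto simp: H_def biclique_on_def A_def C_def)
  have cover: "\<exists>d\<in>E. v \<in> pverts (H d)" if "v \<in> pverts (bipartite_transformation X r)" for v
  proof -
    have "v \<in> Inl ` (min_elems X r \<union> ?M) \<or> v \<in> Inr ` (max_elems X r \<union> ?M)"
      using that by (simp add: bipartite_transformation_def)
    then show ?thesis
    proof
      assume "v \<in> Inl ` (min_elems X r \<union> ?M)"
      then obtain x where x: "v = Inl x" "x \<in> min_elems X r \<union> ?M" by blast
      then have "f x \<in> E" "v \<in> pverts (H (f x))"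
        using f(2)[OF x(2)] by (auto simp: E_def H_def biclique_on_def A_def)
      then show ?thesis by blast
    next
      assume "v \<in> Inr ` (max_elems X r \<union> ?M)"
      then obtain x where x: "v = Inr x" "x \<in> max_elems X r \<union> ?M" by blast
      then have "g x \<in> E" "v \<in> pverts (H (g x))"
        using g(2)[OF x(2)] by (auto simp: E_def H_def biclique_on_def C_def)
      then show ?thesis by blast
    qed
  qed
  have "biclique_vertex_partition (H ` E) (bipartite_transformation X r)"
    unfolding biclique_vertex_partition_def disjoint_family_on_def
  proof (intro conjI ballI impI)
    fix K assume "K \<in> H ` E"
    then show "biclique K (bipartite_transformation X r)"
      using H by blast
  next
    fix K L assume "K \<in> H ` E" "L \<in> H ` E" "K \<noteq> L"
    then show "pverts K \<inter> pverts L = {}"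
      using unique by blast
  next
    fix v assume "v \<in> pverts (bipartite_transformation X r)"
    then show "\<exists>!K. K \<in> H ` E \<and> v \<in> pverts K"
      using cover unique by blast
  qed
  moreover have "card (H ` E) \<le> card D"
    using card_image_le[OF E(1), of H] E(2) by linarith
  ultimately show ?thesis
    using E(1) by blast
qed

section \<open>From a biclique partition to a bracketing set\<close>

lemma mid_induct [consumes 1, case_names less]:
  assumes "x \<in> mid_elems X r"
    and step: "\<And>x. x \<in> mid_elems X r \<Longrightarrow>
      (\<And>a. a \<in> mid_elems X r \<Longrightarrow> strictly_below r a x \<Longrightarrow> P a) \<Longrightarrow> P x"
  shows "P x"
  using assms(1)
proof (induction "card {y. (y, x) \<in> r}" arbitrary: x rule: less_induct)
  case less
  show ?case
  proof (rule step[OF less.prems])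
    fix a assume a: "a \<in> mid_elems X r" "strictly_below r a x"
    have "finite {y. (y, x) \<in> r}"
      by (rule finite_subset[OF _ finite]) (use carrier in auto)
    \<comment> \<open>The inclusion is strict because \<open>x\<close> lies in its own down-set, but
      not in that of \<open>a\<close>.\<close>
    moreover have "{y. (y, a) \<in> r} \<subset> {y. (y, x) \<in> r}"
      using a trans antisym refl elems_subset less.prems unfolding strictly_below_def by blast
    ultimately show "P a"
      using less.hyps a(1) psubset_card_mono by blast
  qed
qed

definition centre :: "'a set \<Rightarrow> 'a set \<Rightarrow> 'a \<Rightarrow> bool" where
  "centre A C d \<longleftrightarrow> d \<in> X \<and>
     (\<forall>x \<in> mid_elems X r \<inter> A. (x, d) \<in> r) \<and> (\<forall>x \<in> mid_elems X r \<inter> C. (d, x) \<in> r)"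

text \<open>Two obvious candidates for a centre must fail. If \<open>A\<close> had no middle
  element, any member of \<open>A\<close> would be a centre. So \<open>A\<close> contains a middle
  \<open>a\<close>, which is below \<open>x\<close>; if \<open>a = x\<close>, then \<open>x\<close>
  would belong to both sides and be a centre itself.\<close>

lemma mid_below_uncentred:
  assumes "A \<noteq> {}"
    and le: "\<And>x y. x \<in> A \<Longrightarrow> y \<in> C \<Longrightarrow> (x, y) \<in> r"
    and uncentred: "\<nexists>d. centre A C d"
    and x: "x \<in> C"
  shows "\<exists>a\<in>mid_elems X r. strictly_below r a x"
proof -
  obtain b where b: "b \<in> A"
    using \<open>A \<noteq> {}\<close> by blast
  have "mid_elems X r \<inter> A \<noteq> {}"
  proof
    assume "mid_elems X r \<inter> A = {}"
    then have "centre A C b"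
      using le[OF b] carrier[OF le[OF b x]] by (simp add: centre_def)
    then show False using uncentred by blast
  qed
  then obtain a where a: "a \<in> mid_elems X r" "a \<in> A" by blast
  have "a \<noteq> x"
  proof
    assume "a = x"
    then have "centre A C x"
      using le[OF a(2)] le[OF _ x] carrier[OF le[OF a(2) x]] by (simp add: centre_def)
    then show False using uncentred by blast
  qed
  then show ?thesis
    using a le[OF a(2) x] unfolding strictly_below_def by blast
qed

text \<open>The bound is claimed for all centres of the biclique, because the one used later is
  picked by \<open>SOME\<close>; the existence clause keeps the claim from being vacuous. Stated for
  abstract families \<open>A\<close> and \<open>C\<close>, it can be reused in the reversed order
  with the sides exchanged.\<close>

lemma centre_below:
  assumes "x \<in> mid_elems X r"
    and nonempty: "\<And>i. i \<in> I \<Longrightarrow> A i \<noteq> {}"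
    and le: "\<And>i x y. i \<in> I \<Longrightarrow> x \<in> A i \<Longrightarrow> y \<in> C i \<Longrightarrow> (x, y) \<in> r"
    and cover: "\<And>x. x \<in> mid_elems X r \<Longrightarrow> \<exists>i\<in>I. x \<in> C i"
  shows "\<exists>i\<in>I. (\<exists>d. centre (A i) (C i) d) \<and> (\<forall>d. centre (A i) (C i) d \<longrightarrow> (d, x) \<in> r)"
  using assms(1)
proof (induction rule: mid_induct)
  case (less x)
  obtain i where i: "i \<in> I" "x \<in> C i"
    using cover less.hyps by blast
  show ?case
  proof (cases "\<exists>d. centre (A i) (C i) d")
    case True
    then show ?thesis
      \<comment> \<open>Since \<open>x\<close> is a middle element of \<open>C i\<close>, every
        centre of this biclique lies below it.\<close>
      using i less.hyps unfolding centre_def by blast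
  next
    case False
    then obtain a where a: "a \<in> mid_elems X r" "strictly_below r a x"
      using mid_below_uncentred[of "A i" "C i" x] nonempty le i by blast
    then have "(a, x) \<in> r"
      by (simp add: strictly_below_def)
    then show ?thesis
      using less.IH[OF a] trans[of _ a x] by blast
  qed
qed

lemma bracketing_of_partition:
  assumes \<B>: "biclique_vertex_partition \<B> (bipartite_transformation X r)" "finite \<B>"
  shows "\<exists>D. bracketing X r D \<and> finite D \<and> card D \<le> card \<B>"
proof -
  interpret op: finite_poset3 X "r\<inverse>"
    by (rule dual)
  define A where "A H = {x. Inl x \<in> pverts H}" for H :: "('a + 'a) pair_pre_digraph"
  define C where "C H = {x. Inr x \<in> pverts H}" for H :: "('a + 'a) pair_pre_digraph"
  have bicl: "biclique H (bipartite_transformation X r)" if "H \<in> \<B>" for H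
    using \<B> that by (simp add: biclique_vertex_partition_def)
  have nonempty: "A H \<noteq> {}" "C H \<noteq> {}" if "H \<in> \<B>" for H
    unfolding A_def C_def by (rule bicliqueE[OF bicl[OF that]], blast)+
  have le: "(x, y) \<in> r" if "H \<in> \<B>" "x \<in> A H" "y \<in> C H" for H x y
    by (rule bicliqueE[OF bicl[OF that(1)]]) (use that in \<open>simp add: A_def C_def\<close>)
  have cover: "\<exists>H\<in>\<B>. x \<in> A H" "\<exists>H\<in>\<B>. x \<in> C H" if "x \<in> mid_elems X r" for x
  proof -
    have "Inl x \<in> pverts (bipartite_transformation X r)" "Inr x \<in> pverts (bipartite_transformation X r)"
      using that by (auto simp: bipartite_transformation_def)
    then show "\<exists>H\<in>\<B>. x \<in> A H" "\<exists>H\<in>\<B>. x \<in> C H"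
      using \<B>(1) unfolding biclique_vertex_partition_def A_def C_def by blast+
  qed
  \<comment> \<open>Reversing the order and exchanging the sides preserves centres, so a single
    choice of centres serves for both the lower and the upper bracket.\<close>
  have centre_dual: "op.centre (C H) (A H) d \<longleftrightarrow> centre (A H) (C H) d" for H d
    by (auto simp: op.centre_def centre_def)
  \<comment> \<open>One centre per biclique that has any; a biclique without centre contributes
    nothing, which gives the cardinality bound.\<close>
  define D where "D = (\<lambda>H. SOME d. centre (A H) (C H) d) ` {H \<in> \<B>. \<exists>d. centre (A H) (C H) d}"
  have D: "\<exists>d\<in>D. centre (A H) (C H) d" if "H \<in> \<B>" "\<exists>d. centre (A H) (C H) d" for H
    using that someI_ex[OF that(2)] by (auto simp: D_def)
  have "D \<subseteq> X"
  proof
    fix d assume "d \<in> D"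
    then obtain H where "d = (SOME d. centre (A H) (C H) d)" "\<exists>d. centre (A H) (C H) d"
      by (auto simp: D_def)
    then have "centre (A H) (C H) d"
      using someI_ex by metis
    then show "d \<in> X" by (simp add: centre_def)
  qed
  moreover have "\<exists>a\<in>D. (a, x) \<in> r" if x: "x \<in> mid_elems X r" for x
  proof -
    have "\<exists>H\<in>\<B>. (\<exists>d. centre (A H) (C H) d) \<and> (\<forall>d. centre (A H) (C H) d \<longrightarrow> (d, x) \<in> r)"
      by (rule centre_below) (use x nonempty(1) le cover(2) in auto)
    then obtain H where "H \<in> \<B>" "\<exists>d. centre (A H) (C H) d"
        "\<forall>d. centre (A H) (C H) d \<longrightarrow> (d, x) \<in> r"
      by blast
    then show ?thesis using D by blast
  qed
  moreover have "\<exists>b\<in>D. (x, b) \<in> r" if x: "x \<in> mid_elems X r" for x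
  proof -
    have "\<exists>H\<in>\<B>. (\<exists>d. op.centre (C H) (A H) d) \<and> (\<forall>d. op.centre (C H) (A H) d \<longrightarrow> (d, x) \<in> r\<inverse>)"
      by (rule op.centre_below) (use x nonempty(2) le cover(1) in auto)
    then obtain H where "H \<in> \<B>" "\<exists>d. centre (A H) (C H) d"
        "\<forall>d. centre (A H) (C H) d \<longrightarrow> (x, d) \<in> r"
      unfolding centre_dual by auto
    then show ?thesis using D by blast
  qed
  ultimately have "bracketing X r D"
    by (simp add: bracketing_def)
  moreover have "finite D"
    using \<B>(2) by (simp add: D_def)
  moreover have "card D \<le> card \<B>"
    unfolding D_def using \<B>(2) by (intro card_image_le[THEN order_trans] card_mono) auto
  ultimately show ?thesis by blast
qed

section \<open>Equality of the two parameters\<close>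

lemma bp_eq_gamma_os: "bp (bipartite_transformation X r) = gamma_os X r"
  unfolding bp_def gamma_os_def
\<comment> \<open>After the exchange of sides, satisfiability is to be shown for domination, where
  the whole carrier is a witness.\<close>
proof (rule sym, rule Least_eq_Least)
  have "bracketing X r X"
    using refl elems_subset unfolding bracketing_def by blast
  then show "\<exists>n D. order_sensitive_dominating_set X r D \<and> finite D \<and> card D = n"
    using finite order_sensitive_dominating_set_iff_bracketing by blast
next
  fix n assume "\<exists>D. order_sensitive_dominating_set X r D \<and> finite D \<and> card D = n"
  then show "\<exists>m\<le>n. \<exists>\<B>. biclique_vertex_partition \<B> (bipartite_transformation X r) \<and>
      finite \<B> \<and> card \<B> = m"
    using partition_of_bracketing order_sensitive_dominating_set_iff_bracketing by metis
next
  fix n assume "\<exists>\<B>. biclique_vertex_partition \<B> (bipartite_transformation X r) \<and>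
      finite \<B> \<and> card \<B> = n"
  then show "\<exists>m\<le>n. \<exists>D. order_sensitive_dominating_set X r D \<and> finite D \<and> card D = m"
    using bracketing_of_partition order_sensitive_dominating_set_iff_bracketing by metis
qed

end

theorem theorem41:
  fixes X :: "'a set" and r :: "'a rel" and k :: nat
  assumes "3 \<le> k"
    and "finite X"
    and "(X, r) \<in> posets3 k"
  shows "bp (bipartite_transformation X r) = gamma_os X r"
proof -
  interpret finite_poset3 X r
    using assms by unfold_locales (auto simp: posets3_def)
  show ?thesis by (rule bp_eq_gamma_os)
qed

end
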